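(* Let $n\ge 5$. Consider an LP $\max c^t x$ s.t. $Ax\le b$, $x\in\mathbb{R}^n_{\ge 0}$, with $A\in\mathbb{R}^{m\times n}$, $b\in\mathbb{R}^m$, $c\in\mathbb{R}^n\setminus\{0\}$, that has a symmetry group $G\le \mathrm{S}_n$ isomorphic to the alternating group $\mathrm{A}_n$ or to the symmetric group $\mathrm{S}_n$ (so that $c=(\gamma,\dots,\gamma)^t$ for some real $\gamma\neq 0$). Let $(a,\dots,a)^t$ be a solution of the LP. Then testing the feasibility of one neighbor on every $c$-layer, beginning with the $\lfloor na\rfloor$-th $c$-layer down to the $(n\lfloor a\rfloor)$-th $c$-layer, either leads to a solution of the corresponding IP or reveals its infeasibility. That is, choosing for each integer $k$ with $n\lfloor a\rfloor\le k\le\lfloor na\rfloor$ one neighbor $N_k$ in the $k$-th $c$-layer and testing the $N_k$ in order of decreasing $k$, the first feasible $N_k$ found is a solution of the corresponding IP, and if none of the $N_k$ is feasible, then the corresponding IP is infeasible. The algorithm stops after at most $n$ steps.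
   Context: The IP corresponding to the LP is: $\max c^t x$ s.t. $Ax\le b$, $x\in\mathbb{R}^n_{\ge0}$, $x\in\mathbb{Z}^n$. A point is feasible for the LP (IP) if it satisfies all its constraints; a solution is a feasible point maximizing $c^tx$ over all feasible points; the IP is infeasible if it has no feasible point. The group $\mathrm{S}_n$ acts linearly on $\mathbb{R}^n$ by permuting the standard basis vectors, $e_i\mapsto e_{i^g}$. A symmetry of the LP (and of the corresponding IP) is an element $g\in\mathrm{S}_n$ with $c^g=c$ for which there is a row permutation $\sigma\in\mathrm{S}_m$ with $b^\sigma=b$ and $P_\sigma A P_g=A$, where $P_\sigma,P_g$ are the corresponding permutation matrices. A symmetry group of the LP is a subgroup $G\le\mathrm{S}_n$ consisting of symmetries. For $c=(\gamma,\dots,\gamma)^t$ with $\gamma\ne0$, the $k$-th $c$-layer ($k\in\mathbb{Z}$) is the affine hyperplane $\{x\in\mathbb{R}^n : x_1+\dots+x_n=k\}$; its center is $(\frac kn,\dots,\frac kn)^t$, the intersection of the layer with the line spanned by $c$. A neighbor in a $c$-layer is an integer point of the layer having minimal Euclidean distance from the center among all integer points of the layer.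
   Formalization: The search from layer ⌊na⌋ down to n⌊a⌋ is claimed only for γ>0; for γ<0, where it fails (n=5, maximize −Σx_i with Σx_i ≥ 5/2), the search goes from layer ⌈na⌉ up to n⌈a⌉ instead. *)

theory Defs
  imports "HOL-Analysis.Analysis" "HOL-Algebra.Bij" "HOL-Algebra.Sym_Groups"
begin

text \<open>The order on \<^typ>\<open>real ^ 'n\<close> is componentwise.\<close>

definition lp_feasible :: "real ^ 'n ^ 'm \<Rightarrow> real ^ 'm \<Rightarrow> real ^ 'n \<Rightarrow> bool" where
  "lp_feasible A b x \<longleftrightarrow> A *v x \<le> b \<and> 0 \<le> x"

definition integer_point :: "real ^ 'n \<Rightarrow> bool" where
  "integer_point x \<longleftrightarrow> (\<forall>i. x $ i \<in> \<int>)"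

definition ip_feasible :: "real ^ 'n ^ 'm \<Rightarrow> real ^ 'm \<Rightarrow> real ^ 'n \<Rightarrow> bool" where
  "ip_feasible A b x \<longleftrightarrow> lp_feasible A b x \<and> integer_point x"

definition lp_solution ::
  "real ^ 'n ^ 'm \<Rightarrow> real ^ 'm \<Rightarrow> real ^ 'n \<Rightarrow> real ^ 'n \<Rightarrow> bool" where
  "lp_solution A b c x \<longleftrightarrow> is_arg_max (\<lambda>y. c \<bullet> y) (lp_feasible A b) x"

definition ip_solution ::
  "real ^ 'n ^ 'm \<Rightarrow> real ^ 'm \<Rightarrow> real ^ 'n \<Rightarrow> real ^ 'n \<Rightarrow> bool" where
  "ip_solution A b c x \<longleftrightarrow> is_arg_max (\<lambda>y. c \<bullet> y) (ip_feasible A b) x"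

definition ip_infeasible :: "real ^ 'n ^ 'm \<Rightarrow> real ^ 'm \<Rightarrow> bool" where
  "ip_infeasible A b \<longleftrightarrow> \<not> (\<exists>x. ip_feasible A b x)"

text \<open>Column \<open>j\<close> is the unit vector with index \<open>g j\<close>, so that the matrix maps \<open>axis j 1\<close>
  to \<open>axis (g j) 1\<close>.\<close>

definition perm_matrix :: "('n \<Rightarrow> 'n) \<Rightarrow> real ^ 'n ^ 'n" where
  "perm_matrix g = (\<chi> i j. if i = g j then 1 else 0)"

definition lp_symmetry ::
  "real ^ 'n ^ 'm \<Rightarrow> real ^ 'm \<Rightarrow> real ^ 'n \<Rightarrow> ('n \<Rightarrow> 'n) \<Rightarrow> bool" where
  "lp_symmetry A b c g \<longleftrightarrow> bij g \<and> perm_matrix g *v c = c \<and>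
     (\<exists>\<sigma>. bij \<sigma> \<and> perm_matrix \<sigma> *v b = b \<and> perm_matrix \<sigma> ** A ** perm_matrix g = A)"

definition lp_symmetry_group ::
  "real ^ 'n ^ 'm \<Rightarrow> real ^ 'm \<Rightarrow> real ^ 'n \<Rightarrow> ('n \<Rightarrow> 'n) set \<Rightarrow> bool" where
  "lp_symmetry_group A b c G \<longleftrightarrow>
     subgroup G (BijGroup UNIV) \<and> (\<forall>g\<in>G. lp_symmetry A b c g)"

text \<open>Layers and their centers do not depend on the common value of the entries of \<open>c\<close>.\<close>

definition c_layer :: "int \<Rightarrow> (real ^ 'n) set" where
  "c_layer k = {x. (\<Sum>i\<in>UNIV. x $ i) = of_int k}"

definition layer_center :: "int \<Rightarrow> real ^ 'n" where
  "layer_center k = (\<chi> i. of_int k / of_nat CARD('n))"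

definition is_neighbor :: "int \<Rightarrow> real ^ 'n \<Rightarrow> bool" where
  "is_neighbor k x \<longleftrightarrow>
     is_arg_min (\<lambda>y. dist y (layer_center k)) (\<lambda>y. y \<in> c_layer k \<and> integer_point y) x"

text \<open>Testing one neighbor on each layer in the list \<open>ks\<close>, from its head onwards: for every
  choice of neighbors, the first feasible one is a solution of the integer program, and if no
  chosen neighbor is feasible then the integer program is infeasible.\<close>

definition layer_search_correct ::
  "real ^ 'n ^ 'm \<Rightarrow> real ^ 'm \<Rightarrow> real ^ 'n \<Rightarrow> int list \<Rightarrow> bool" where
  "layer_search_correct A b c ks \<longleftrightarrow>
     (\<forall>N. (\<forall>k\<in>set ks. is_neighbor k (N k)) \<longrightarrow>
        (case List.find (ip_feasible A b) (map N ks) of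
           Some x \<Rightarrow> ip_solution A b c x
         | None \<Rightarrow> ip_infeasible A b))"

text \<open>The layers in order of worsening objective value. If \<open>c\<close> is a positive multiple of the
  all-ones vector, the solution \<open>(a,\<dots>,a)\<close> bounds coordinate sums from above and the layers
  descend from \<open>\<lfloor>n a\<rfloor>\<close> to \<open>n \<lfloor>a\<rfloor>\<close>. If it is a negative multiple, coordinate sums are bounded
  from below, and a descending search would be wrong: on five variables, minimizing the
  coordinate sum subject to its being at least \<open>5/2\<close> has the solution \<open>(1/2,\<dots>,1/2)\<close> and no
  feasible point on the layers 2, 1, 0, yet integer feasible points exist.\<close>

definition layers_down :: "nat \<Rightarrow> real \<Rightarrow> int list" where
  "layers_down n a = rev [int n * \<lfloor>a\<rfloor> .. \<lfloor>real n * a\<rfloor>]"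

definition layers_up :: "nat \<Rightarrow> real \<Rightarrow> int list" where
  "layers_up n a = [\<lceil>real n * a\<rceil> .. int n * \<lceil>a\<rceil>]"

end

theory Submission
  imports Defs
begin

text \<open>
  The isomorphism type of \<open>G\<close> fixes its order as \<open>n!\<close> or \<open>n!/2\<close>, so \<open>G\<close> contains all squares of
  permutations and therefore all products of two transpositions
  (\<open>exchange_pair_in_large_subgroup\<close>). Hence \<open>c\<close> is constant and the LP-feasible region \<open>S\<close> is a
  convex set invariant under even coordinate permutations.

  The heart of the proof is that one neighbor decides a whole layer: if some integer point of a
  layer lies in \<open>S\<close>, then so does every neighbor (\<open>neighbor_mem\<close>). Neighbors are balanced, that is,
  their entries differ by at most 1, since otherwise moving a unit from a large entry to a small one
  would shorten the distance from the center. Conversely, any integer point of \<open>S\<close> can be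
  transformed into a given balanced point of the same layer inside \<open>S\<close> (\<open>balanced_point_mem\<close>). Under
  the full symmetric group this is the usual transfer argument: moving a unit between two entries
  is a convex combination of the point and the point with these entries exchanged. The alternating
  group permits this as soon as two entries of the point agree. If all entries are distinct, five
  of them contain three whose sum is divisible by 3, and averaging over a 3-cycle replaces these
  three by their integral mean, which decreases the sum of squares.

  It remains to bound the layers. The LP solution \<open>(a,\<dots>,a)\<close> limits them on one side. On the other
  side, let a feasible integer point lie in a layer beyond the searched range, say with \<open>\<gamma> > 0\<close> and
  index \<open>k < n \<lfloor>a\<rfloor>\<close>. The center \<open>(k/n,\<dots>,k/n)\<close> of its layer belongs to \<open>S\<close>, by the same argument
  applied to the dilation of \<open>S\<close> by \<open>n\<close> (\<open>center_mem\<close>). By convexity \<open>(\<lfloor>a\<rfloor>,\<dots>,\<lfloor>a\<rfloor>)\<close> then is a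
  feasible integer point with a better objective value, in the last layer of the search. For
  \<open>\<gamma> < 0\<close> the picture is reflected, with ceilings instead of floors.
\<close>

section \<open>Balanced points and even coordinate permutations\<close>

text \<open>The transposition of two indices; the short name \<open>transpose\<close> would be read as that of matrices.\<close>

abbreviation exchange :: "'a \<Rightarrow> 'a \<Rightarrow> 'a \<Rightarrow> 'a" where
  "exchange \<equiv> Transposition.transpose"

text \<open>Products of two transpositions generate the alternating group, so this says that \<open>S\<close> is a union
  of orbits of even coordinate permutations.\<close>

definition even_invariant :: "(real ^ 'n) set \<Rightarrow> bool" where
  "even_invariant S \<longleftrightarrow>
     (\<forall>x\<in>S. \<forall>i j k l. i \<noteq> j \<longrightarrow> k \<noteq> l \<longrightarrow> (\<chi> h. x $ exchange i j (exchange k l h)) \<in> S)"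

definition int_vec :: "('n \<Rightarrow> int) \<Rightarrow> real ^ 'n" where
  "int_vec X = (\<chi> i. of_int (X i))"

text \<open>A vector with two equal entries does not notice their exchange, so an odd permutation of it is
  also an even one. Thus a single exchange keeps such a vector in \<open>S\<close>.\<close>

lemma exchange_mem:
  assumes "even_invariant S" "int_vec X \<in> S" "i \<noteq> j" "k \<noteq> l" "X k = X l"
  shows "int_vec (X \<circ> exchange i j) \<in> S"
proof -
  have "X (exchange k l h) = X h" for h
    using assms(5) by (auto simp: Transposition.transpose_def)
  then have "(\<chi> h. int_vec X $ exchange k l (exchange i j h)) = int_vec (X \<circ> exchange i j)"
    by (simp add: int_vec_def)
  then show ?thesis
    using assms(1-4) unfolding even_invariant_def by metis
qed

text \<open>Moving one unit from a larger to a smaller entry stays on the segment between \<open>X\<close> and the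
  vector with these two entries exchanged; this is the transfer step of majorization theory.\<close>

lemma unit_transfer_mem:
  assumes "convex S" "int_vec X \<in> S" "int_vec (X \<circ> exchange i j) \<in> S" "X j < X i"
  shows "int_vec (X(i := X i - 1, j := X j + 1)) \<in> S"
proof -
  define t where "t = 1 / (of_int (X i - X j) :: real)"
  have t: "0 \<le> t" "t \<le> 1" and td: "t * of_int (X i) = t * of_int (X j) + 1"
    using assms(4) by (auto simp: t_def field_simps)
  have "i \<noteq> j" using assms(4) by auto
  \<comment> \<open>\<open>t\<close> is chosen so that moving towards the exchanged vector transfers exactly one unit.\<close>
  have "(1 - t) *\<^sub>R int_vec X + t *\<^sub>R int_vec (X \<circ> exchange i j)
      = int_vec (X(i := X i - 1, j := X j + 1))"
    using td \<open>i \<noteq> j\<close>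
    by (auto simp: vec_eq_iff int_vec_def Transposition.transpose_def algebra_simps)
  with convexD[OF assms(1-3), of "1 - t" t] t show ?thesis
    by simp
qed

text \<open>For a vector with distinct entries single exchanges are out of reach, but 3-cycles are even, and
  the mean of the three rotations of a triple of entries replaces each of them by its average.\<close>

lemma three_mean_mem:
  assumes "convex S" "even_invariant S" "int_vec X \<in> S"
    and "i \<noteq> j" "j \<noteq> k" "i \<noteq> k" and m: "X i + X j + X k = 3 * m"
  shows "int_vec (X(i := m, j := m, k := m)) \<in> S"
proof -
  define Y where "Y = (\<chi> h. int_vec X $ exchange i j (exchange j k h))"
  define Z where "Z = (\<chi> h. int_vec X $ exchange j k (exchange i j h))"
  have mem: "Y \<in> S" "Z \<in> S"
    using assms(2-6) unfolding even_invariant_def Y_def Z_def by blast+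
  have m': "of_int m = (of_int (X i) + of_int (X j) + of_int (X k)) / (3 :: real)"
    using arg_cong[OF m, of "of_int :: int \<Rightarrow> real"] by simp
  \<comment> \<open>The mean of the three rotations of the entries at \<open>i\<close>, \<open>j\<close>, \<open>k\<close>, nested as two binary combinations.\<close>
  have "(1/3) *\<^sub>R int_vec X + (2/3) *\<^sub>R ((1/2) *\<^sub>R Y + (1/2) *\<^sub>R Z)
      = int_vec (X(i := m, j := m, k := m))"
    using assms(4-6)
    by (auto simp: vec_eq_iff int_vec_def Y_def Z_def Transposition.transpose_def m' field_simps)
  moreover have "(1/2) *\<^sub>R Y + (1/2) *\<^sub>R Z \<in> S"
    using convexD[OF assms(1) mem, of "1/2" "1/2"] by simp
  then have "(1/3) *\<^sub>R int_vec X + (2/3) *\<^sub>R ((1/2) *\<^sub>R Y + (1/2) *\<^sub>R Z) \<in> S"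
    by (intro convexD[OF assms(1,3)]) auto
  ultimately show ?thesis
    by metis
qed

text \<open>The case 3 of the Erdos--Ginzburg--Ziv theorem: among five integers either three share a residue
  modulo 3, or all three residues occur. It provides the triples with integral mean for
  \<open>three_mean_mem\<close>, and is the reason for the bound 5 on the dimension.\<close>

lemma three_sum_divisible:
  fixes X :: "'a :: finite \<Rightarrow> int"
  assumes "CARD('a) \<ge> 5"
  obtains i j k where "i \<noteq> j" "j \<noteq> k" "i \<noteq> k" "3 dvd X i + X j + X k"
proof -
  define R where "R r = {i. X i mod 3 = r}" for r
  have UN: "UNIV = R 0 \<union> R 1 \<union> R 2"
    by (auto simp: R_def)
  have "card (R 0 \<union> R 1 \<union> R 2) \<le> card (R 0) + card (R 1) + card (R 2)"
    by (meson add_mono card_Un_le le_trans order_refl)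
  then have total: "5 \<le> card (R 0) + card (R 1) + card (R 2)"
    using assms UN by simp
  show thesis
  proof (cases "\<exists>r. 3 \<le> card (R r)")
    case True
    then obtain r T where T: "T \<subseteq> R r" "card T = 3"
      by (meson obtain_subset_with_card_n)
    then obtain i j k where "T = {i, j, k}" "i \<noteq> j" "j \<noteq> k" "i \<noteq> k"
      by (metis card_3_iff)
    moreover from this T(1) have "X i mod 3 = r" "X j mod 3 = r" "X k mod 3 = r"
      by (auto simp: R_def)
    then have "3 dvd X i + X j + X k"
      by presburger
    ultimately show thesis using that by blast
  next
    case False
    then have "card (R r) < 3" for r by (meson not_le)
    from this[of 0] this[of 1] this[of 2] total
    have "0 < card (R 0)" "0 < card (R 1)" "0 < card (R 2)" by linarith+
    then obtain i j k where "i \<in> R 0" "j \<in> R 1" "k \<in> R 2"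
      by (metis card_gt_0_iff ex_in_conv)
    then have *: "X i mod 3 = 0" "X j mod 3 = 1" "X k mod 3 = 2"
      by (auto simp: R_def)
    moreover from * have "3 dvd X i + X j + X k"
      by presburger
    moreover have "i \<noteq> j" "j \<noteq> k" "i \<noteq> k"
      using * by auto
    ultimately show thesis using that by blast
  qed
qed

lemma sum_change_on:
  fixes f g :: "'a :: finite \<Rightarrow> 'b :: ab_group_add"
  assumes "\<And>h. h \<notin> D \<Longrightarrow> g h = f h"
  shows "sum g UNIV = sum f UNIV + (sum g D - sum f D)"
proof -
  have "sum g UNIV = sum g (- D) + sum g D" "sum f UNIV = sum f (- D) + sum f D"
    using sum.subset_diff[of D UNIV] by (simp_all add: Compl_eq_Diff_UNIV)
  moreover have "sum g (- D) = sum f (- D)"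
    using assms by (intro sum.cong) auto
  ultimately show ?thesis by simp
qed

text \<open>An integer point of \<open>S\<close> reaches every balanced integer point with the same sum without leaving
  \<open>S\<close>. If two entries agree, one unit is transferred from an entry above its target value in \<open>N\<close> to
  one below it: this does not increase the sum of squares and brings the point closer to \<open>N\<close>. If all
  entries are distinct, three of them are replaced by their integral mean, which decreases the sum
  of squares but may lead away from \<open>N\<close>. Hence the lexicographic measure with the sum of squares
  first. In the first case the transfer may be a mere exchange of values differing by 1, which
  leaves the sum of squares unchanged, so the second component is needed.\<close>

lemma balanced_point_mem:
  fixes S :: "(real ^ 'n) set" and X N :: "'n \<Rightarrow> int"
  assumes card5: "CARD('n) \<ge> 5" and conv: "convex S" and inv: "even_invariant S"
    and balanced: "\<And>i j. N i \<le> N j + 1"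
    and "int_vec X \<in> S" "sum X UNIV = sum N UNIV"
  shows "int_vec N \<in> S"
proof -
  define sq where "sq X = (\<Sum>i\<in>UNIV. (X i)\<^sup>2)" for X :: "'n \<Rightarrow> int"
  define ds where "ds X = (\<Sum>i\<in>UNIV. \<bar>X i - N i\<bar>)" for X :: "'n \<Rightarrow> int"
  have nonneg: "0 \<le> sq X" "0 \<le> ds X" for X
    by (auto simp: sq_def ds_def intro: sum_nonneg)
  have "wf (measures [\<lambda>X. nat (sq X), \<lambda>X. nat (ds X)])"
    by simp
  then show ?thesis
    using assms(5,6)
  proof (induction X rule: wf_induct_rule)
    case (less X)
    show ?case
    proof (cases "X = N")
      case True
      with less.prems show ?thesis by simp
    next
      case neq: False
      show ?thesis
      proof (cases "inj X")
        case True
        obtain i j k where ijk: "i \<noteq> j" "j \<noteq> k" "i \<noteq> k" and "3 dvd X i + X j + X k"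
          using three_sum_divisible[OF card5] .
        then obtain m where m: "X i + X j + X k = 3 * m" by blast
        define Y where "Y = X(i := m, j := m, k := m)"
        have Y: "int_vec Y \<in> S"
          unfolding Y_def by (rule three_mean_mem[OF conv inv less.prems(1) ijk m])
        have "sum Y UNIV = sum X UNIV + (3 * m - (X i + X j + X k))"
          using sum_change_on[of "{i, j, k}" Y X] ijk by (simp add: Y_def)
        then have sumY: "sum Y UNIV = sum N UNIV"
          using m less.prems(2) by simp
        \<comment> \<open>Three distinct values have a strictly larger sum of squares than three copies of their mean.\<close>
        have "X i \<noteq> X j"
          using True ijk by (auto simp: inj_eq)
        then have "0 < (X i - X j)\<^sup>2" by simp
        then have "0 < (X i - X j)\<^sup>2 + (X i - X k)\<^sup>2 + (X j - X k)\<^sup>2"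
          by (smt (verit) zero_le_power2)
        also have "\<dots> = 3 * ((X i)\<^sup>2 + (X j)\<^sup>2 + (X k)\<^sup>2) - (X i + X j + X k)\<^sup>2"
          by (simp add: power2_eq_square algebra_simps)
        finally have "3 * m\<^sup>2 < (X i)\<^sup>2 + (X j)\<^sup>2 + (X k)\<^sup>2"
          unfolding m by (simp add: power2_eq_square)
        moreover have "sq Y = sq X + (3 * m\<^sup>2 - ((X i)\<^sup>2 + (X j)\<^sup>2 + (X k)\<^sup>2))"
          using sum_change_on[of "{i, j, k}" "\<lambda>h. (Y h)\<^sup>2" "\<lambda>h. (X h)\<^sup>2"] ijk
          by (simp add: Y_def sq_def)
        ultimately have "sq Y < sq X" by simp
        then have "(Y, X) \<in> measures [\<lambda>X. nat (sq X), \<lambda>X. nat (ds X)]"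
          using nonneg(1)[of Y] by simp
        from less.IH[OF this Y sumY] show ?thesis .
      next
        case False
        then obtain k l where kl: "k \<noteq> l" "X k = X l"
          by (auto simp: inj_def)
        obtain i where i: "N i < X i"
        proof (rule ccontr)
          assume "\<not> thesis"
          then have le: "\<forall>h\<in>UNIV. X h \<le> N h" using that by (meson not_le)
          moreover obtain h where "X h < N h"
            using neq le by (metis UNIV_I ext order_less_le)
          ultimately have "sum X UNIV < sum N UNIV"
            by (intro sum_strict_mono_ex1) auto
          with less.prems show False by simp
        qed
        obtain j where j: "X j < N j"
        proof (rule ccontr)
          assume "\<not> thesis"
          then have "\<forall>h\<in>UNIV. N h \<le> X h" using that by (meson not_le)
          then have "sum N UNIV < sum X UNIV"
            using i by (intro sum_strict_mono_ex1) auto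
          with less.prems show False by simp
        qed
        \<comment> \<open>Balancedness of \<open>N\<close> forces the source of the transfer to exceed its target.\<close>
        have d: "X j < X i"
          using i j balanced[of j i] by linarith
        then have "i \<noteq> j" by auto
        define Y where "Y = X(i := X i - 1, j := X j + 1)"
        have Y: "int_vec Y \<in> S"
          unfolding Y_def
          by (intro unit_transfer_mem[OF conv less.prems(1)]
              exchange_mem[OF inv less.prems(1) \<open>i \<noteq> j\<close> kl] d)
        have "sum Y UNIV = sum X UNIV"
          using sum_change_on[of "{i, j}" Y X] \<open>i \<noteq> j\<close> by (simp add: Y_def)
        then have sumY: "sum Y UNIV = sum N UNIV"
          using less.prems(2) by simp
        have "sq Y = sq X + ((X i - 1)\<^sup>2 + (X j + 1)\<^sup>2 - ((X i)\<^sup>2 + (X j)\<^sup>2))"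
          using sum_change_on[of "{i, j}" "\<lambda>h. (Y h)\<^sup>2" "\<lambda>h. (X h)\<^sup>2"] \<open>i \<noteq> j\<close>
          by (simp add: Y_def sq_def)
        also have "\<dots> = sq X - 2 * (X i - X j - 1)"
          by (simp add: power2_eq_square algebra_simps)
        finally have "sq Y \<le> sq X" using d by simp
        moreover have "ds Y = ds X + (\<bar>X i - 1 - N i\<bar> + \<bar>X j + 1 - N j\<bar>
            - (\<bar>X i - N i\<bar> + \<bar>X j - N j\<bar>))"
          using sum_change_on[of "{i, j}" "\<lambda>h. \<bar>Y h - N h\<bar>" "\<lambda>h. \<bar>X h - N h\<bar>"] \<open>i \<noteq> j\<close>
          by (simp add: Y_def ds_def)
        then have "ds Y < ds X" using i j by simp
        ultimately have "(Y, X) \<in> measures [\<lambda>X. nat (sq X), \<lambda>X. nat (ds X)]"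
          using nonneg[of Y] by auto
        from less.IH[OF this Y sumY] show ?thesis .
      qed
    qed
  qed
qed

lemma even_invariant_scaling:
  assumes "even_invariant S"
  shows "even_invariant ((*\<^sub>R) r ` S)"
  unfolding even_invariant_def
proof (intro ballI allI impI)
  fix x :: "real ^ 'a" and i j k l :: 'a
  assume "x \<in> (*\<^sub>R) r ` S" and ijkl: "i \<noteq> j" "k \<noteq> l"
  then obtain y where y: "y \<in> S" "x = r *\<^sub>R y" by blast
  have "(\<chi> h. x $ exchange i j (exchange k l h)) = r *\<^sub>R (\<chi> h. y $ exchange i j (exchange k l h))"
    by (simp add: vec_eq_iff y)
  then show "(\<chi> h. x $ exchange i j (exchange k l h)) \<in> (*\<^sub>R) r ` S"
    using assms y(1) ijkl unfolding even_invariant_def by blast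
qed

text \<open>Dilating by \<open>n\<close> turns the center of a layer into the integer point with all entries equal to the
  sum of \<open>X\<close>, which is balanced, so averaging over a group is replaced by \<open>balanced_point_mem\<close>.\<close>

lemma center_mem:
  fixes S :: "(real ^ 'n) set" and X :: "'n \<Rightarrow> int"
  assumes "CARD('n) \<ge> 5" "convex S" "even_invariant S" "int_vec X \<in> S"
  shows "layer_center (sum X UNIV) \<in> S"
proof -
  let ?n = "CARD('n)" and ?K = "\<lambda>i :: 'n. sum X UNIV"
  have "int_vec (\<lambda>i. int ?n * X i) = real ?n *\<^sub>R int_vec X"
    by (simp add: int_vec_def vec_eq_iff)
  then have "int_vec (\<lambda>i. int ?n * X i) \<in> (*\<^sub>R) (real ?n) ` S"
    using assms(4) by simp
  then have "int_vec ?K \<in> (*\<^sub>R) (real ?n) ` S"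
    using assms(1-3)
    by (intro balanced_point_mem[of _ ?K "\<lambda>i. int ?n * X i"] convex_scaling
        even_invariant_scaling) (auto simp: sum_distrib_left)
  then obtain y where y: "y \<in> S" "int_vec ?K = real ?n *\<^sub>R y" by blast
  then have "y = layer_center (sum X UNIV)"
    by (simp add: int_vec_def layer_center_def vec_eq_iff field_simps)
  with y show ?thesis by simp
qed

section \<open>Neighbors in a layer\<close>

lemma integer_pointE:
  assumes "integer_point x"
  obtains X where "x = int_vec X"
proof -
  have "x = int_vec (\<lambda>i. \<lfloor>x $ i\<rfloor>)"
    using assms by (simp add: integer_point_def int_vec_def vec_eq_iff)
  then show thesis by (rule that)
qed

lemma int_vec_integer_point: "integer_point (int_vec X)"
  by (simp add: integer_point_def int_vec_def)

lemma int_vec_in_layer_iff: "int_vec X \<in> c_layer k \<longleftrightarrow> sum X UNIV = k"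
  by (simp add: c_layer_def int_vec_def flip: of_int_sum)

text \<open>Within a layer the squared distance from the center is the sum of squares up to a constant.\<close>

lemma dist_layer_center:
  fixes y :: "real ^ 'n"
  assumes "y \<in> c_layer k"
  shows "(dist y (layer_center k))\<^sup>2 = (\<Sum>i\<in>UNIV. (y $ i)\<^sup>2) - (of_int k)\<^sup>2 / CARD('n)"
proof -
  let ?m = "of_int k / real CARD('n)"
  have "(dist y (layer_center k))\<^sup>2 = (\<Sum>i\<in>UNIV. (y $ i - ?m)\<^sup>2)"
    by (simp add: dist_vec_def L2_set_def layer_center_def dist_real_def sum_nonneg)
  also have "\<dots> = (\<Sum>i\<in>UNIV. (y $ i)\<^sup>2) - 2 * ?m * (\<Sum>i\<in>UNIV. y $ i) + CARD('n) * ?m\<^sup>2"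
    by (simp add: power2_diff sum.distrib sum_subtractf flip: sum_distrib_left sum_distrib_right
        sum_divide_distrib)
  also have "\<dots> = (\<Sum>i\<in>UNIV. (y $ i)\<^sup>2) - (of_int k)\<^sup>2 / CARD('n)"
    using assms by (simp add: c_layer_def power2_eq_square field_simps)
  finally show ?thesis .
qed

text \<open>A unit transfer from \<open>i\<close> to \<open>j\<close> would shrink the sum of squares and thus, by
  \<open>dist_layer_center\<close>, the distance from the center.\<close>

lemma neighbor_balanced:
  fixes N :: "'n :: finite \<Rightarrow> int"
  assumes "is_neighbor k (int_vec N)"
  shows "N i \<le> N j + 1"
proof (rule ccontr)
  assume neg: "\<not> N i \<le> N j + 1"
  then have "i \<noteq> j" by auto
  define Y where "Y = N(i := N i - 1, j := N j + 1)"
  have N: "int_vec N \<in> c_layer k"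
    using assms by (simp add: is_neighbor_def is_arg_min_def)
  have "sum Y UNIV = sum N UNIV"
    using sum_change_on[of "{i, j}" Y N] \<open>i \<noteq> j\<close> by (simp add: Y_def)
  then have Y: "int_vec Y \<in> c_layer k"
    using N by (simp add: int_vec_in_layer_iff)
  have "(\<Sum>h\<in>UNIV. (Y h)\<^sup>2)
      = (\<Sum>h\<in>UNIV. (N h)\<^sup>2) + ((N i - 1)\<^sup>2 + (N j + 1)\<^sup>2 - ((N i)\<^sup>2 + (N j)\<^sup>2))"
    using sum_change_on[of "{i, j}" "\<lambda>h. (Y h)\<^sup>2" "\<lambda>h. (N h)\<^sup>2"] \<open>i \<noteq> j\<close>
    by (simp add: Y_def)
  also have "\<dots> = (\<Sum>h\<in>UNIV. (N h)\<^sup>2) - 2 * (N i - N j - 1)"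
    by (simp add: power2_eq_square algebra_simps)
  finally have "(\<Sum>h\<in>UNIV. (Y h)\<^sup>2) < (\<Sum>h\<in>UNIV. (N h)\<^sup>2)"
    using neg by simp
  then have "(\<Sum>h\<in>UNIV. (int_vec Y $ h)\<^sup>2) < (\<Sum>h\<in>UNIV. (int_vec N $ h)\<^sup>2)"
    by (simp add: int_vec_def flip: of_int_power of_int_sum)
  then have "(dist (int_vec Y) (layer_center k))\<^sup>2 < (dist (int_vec N) (layer_center k))\<^sup>2"
    by (simp add: dist_layer_center N Y)
  then have "dist (int_vec Y) (layer_center k) < dist (int_vec N) (layer_center k)"
    by (rule power2_less_imp_less) simp
  then show False
    using assms Y int_vec_integer_point by (auto simp: is_neighbor_def is_arg_min_def)
qed

text \<open>The decisive fact about a single layer: testing one neighbor decides whether the layer contains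
  any integer point of \<open>S\<close>.\<close>

lemma neighbor_mem:
  fixes S :: "(real ^ 'n) set"
  assumes "CARD('n) \<ge> 5" "convex S" "even_invariant S"
    and "x \<in> S" "integer_point x" "x \<in> c_layer k" and "is_neighbor k y"
  shows "y \<in> S"
proof -
  obtain X where X: "x = int_vec X"
    using integer_pointE[OF assms(5)] .
  have y: "integer_point y" "y \<in> c_layer k"
    using assms(7) by (auto simp: is_neighbor_def is_arg_min_def)
  then obtain N where N: "y = int_vec N"
    using integer_pointE by blast
  have "sum X UNIV = sum N UNIV"
    using assms(6) y(2) by (simp add: X N int_vec_in_layer_iff)
  then show ?thesis
    using assms(1-4,7) neighbor_balanced balanced_point_mem unfolding X N by blast
qed

section \<open>Symmetries and the feasible region\<close>

lemma perm_matrix_nth: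
  assumes "bij g"
  shows "(perm_matrix g *v x) $ g j = x $ j"
  using bij_is_inj[OF assms]
  by (simp add: matrix_vector_mult_def perm_matrix_def inj_eq mult_if_delta)

lemma symmetry_objective:
  assumes "lp_symmetry A b c g"
  shows "c $ g j = c $ j"
  using assms perm_matrix_nth unfolding lp_symmetry_def by metis

text \<open>With \<open>y\<close> the permuted vector, \<open>x\<close> is the image of \<open>y\<close> under the permutation matrix of \<open>g\<close>, and
  the rows of \<open>A *v y\<close> are those of \<open>A *v x\<close> rearranged by a permutation that fixes \<open>b\<close>.\<close>

lemma symmetry_feasible:
  assumes "lp_symmetry A b c g" "lp_feasible A b (\<chi> i. x $ g i)"
  shows "lp_feasible A b x"
proof -
  obtain \<sigma> where g: "bij g" and \<sigma>: "bij \<sigma>" and b: "perm_matrix \<sigma> *v b = b"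
    and A: "perm_matrix \<sigma> ** A ** perm_matrix g = A"
    using assms(1) unfolding lp_symmetry_def by blast
  let ?y = "\<chi> i. x $ g i"
  have "(perm_matrix g *v ?y) $ i = x $ i" for i
    using perm_matrix_nth[OF g, of ?y "inv' g i"] g by (simp add: surj_f_inv_f bij_is_surj)
  then have "perm_matrix g *v ?y = x"
    by (simp add: vec_eq_iff)
  then have Ay: "A *v ?y = perm_matrix \<sigma> *v (A *v x)"
    by (metis A matrix_vector_mul_assoc)
  have "(A *v x) $ i \<le> b $ i" for i
  proof -
    have "(A *v x) $ i = (A *v ?y) $ \<sigma> i"
      unfolding Ay by (simp add: perm_matrix_nth[OF \<sigma>])
    also have "\<dots> \<le> b $ \<sigma> i"
      using assms(2) by (simp add: lp_feasible_def less_eq_vec_def)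
    also have "\<dots> = b $ i"
      using perm_matrix_nth[OF \<sigma>, of b i] b by simp
    finally show ?thesis .
  qed
  moreover have "0 \<le> x $ i" for i
  proof -
    have "0 \<le> ?y $ inv' g i"
      using assms(2) unfolding lp_feasible_def less_eq_vec_def by (metis zero_index)
    then show ?thesis
      using g by (simp add: surj_f_inv_f bij_is_surj)
  qed
  ultimately show ?thesis
    by (simp add: lp_feasible_def less_eq_vec_def)
qed

lemma convex_lp_feasible: "convex {x. lp_feasible A b x}"
proof (rule convexI)
  fix x y u v
  assume xy: "x \<in> {x. lp_feasible A b x}" "y \<in> {x. lp_feasible A b x}"
    and uv: "0 \<le> u" "0 \<le> v" "u + v = (1 :: real)"
  have "(A *v (u *\<^sub>R x + v *\<^sub>R y)) $ i \<le> b $ i" for i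
  proof -
    have "(A *v (u *\<^sub>R x + v *\<^sub>R y)) $ i = u * (A *v x) $ i + v * (A *v y) $ i"
      by (simp add: matrix_vector_right_distrib matrix_vector_mult_scaleR)
    also have "\<dots> \<le> u * b $ i + v * b $ i"
      using xy uv by (intro add_mono mult_left_mono) (auto simp: lp_feasible_def less_eq_vec_def)
    also have "\<dots> = b $ i"
      using uv(3) by (simp flip: distrib_right)
    finally show ?thesis .
  qed
  moreover have "0 \<le> (u *\<^sub>R x + v *\<^sub>R y) $ i" for i
    using xy uv by (simp add: lp_feasible_def less_eq_vec_def)
  ultimately show "u *\<^sub>R x + v *\<^sub>R y \<in> {x. lp_feasible A b x}"
    by (simp add: lp_feasible_def less_eq_vec_def)
qed

section \<open>Subgroups of index at most two\<close>

lemma Bij_UNIV: "Bij UNIV = {f. bij f}"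
  by (auto simp: Bij_def)

lemma BijGroup_UNIV_mult: "bij f \<Longrightarrow> bij g \<Longrightarrow> f \<otimes>\<^bsub>BijGroup UNIV\<^esub> g = f \<circ> g"
  by (auto simp: BijGroup_def Bij_UNIV compose_def)

lemma card_bijections: "card {f :: 'n :: finite \<Rightarrow> 'n. bij f} = fact CARD('n)"
proof -
  have "{f :: 'n \<Rightarrow> 'n. bij f} = {f. f permutes UNIV}"
    by (auto intro: bij_imp_permutes permutes_imp_bij)
  then show ?thesis
    by (simp add: card_permutations)
qed

text \<open>For \<open>g\<close> outside the subgroup, \<open>G\<close> and its coset by \<open>g\<close> already exhaust all bijections. The
  isomorphism type of a symmetry group enters through this lemma, by way of the group order.\<close>

lemma squares_in_large_subgroup:
  fixes G :: "('n :: finite \<Rightarrow> 'n) set"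
  assumes G: "subgroup G (BijGroup UNIV)" and large: "fact CARD('n) \<le> 2 * card G"
    and g: "bij g"
  shows "g \<circ> g \<in> G"
proof (rule ccontr)
  assume gg: "g \<circ> g \<notin> G"
  have sub: "G \<subseteq> {f. bij f}"
    using subgroup.subset[OF G] by (simp add: BijGroup_def Bij_UNIV)
  have comp: "f \<circ> h \<in> G" if "f \<in> G" "h \<in> G" for f h
    using subgroup.m_closed[OF G that] subsetD[OF sub] by (simp add: BijGroup_UNIV_mult that)
  have inv: "inv' f \<in> G" if "f \<in> G" for f
  proof -
    interpret group "BijGroup (UNIV :: 'n set)" by (rule group_BijGroup)
    have bf: "bij f" using that sub by auto
    have carr: "f \<in> carrier (BijGroup UNIV)" "inv' f \<in> carrier (BijGroup UNIV)"
      using bf by (simp_all add: BijGroup_def Bij_UNIV bij_imp_bij_inv)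
    have "inv' f \<otimes>\<^bsub>BijGroup UNIV\<^esub> f = \<one>\<^bsub>BijGroup UNIV\<^esub>"
      using bf by (simp add: BijGroup_UNIV_mult bij_imp_bij_inv bij_is_inj,
          simp add: BijGroup_def fun_eq_iff)
    then have "inv\<^bsub>BijGroup UNIV\<^esub> f = inv' f"
      using carr by (simp add: inv_equality)
    then show ?thesis
      using subgroup.m_inv_closed[OF G that] by simp
  qed
  have "g \<notin> G" using gg comp by blast
  have inj: "inj (\<lambda>f :: 'n \<Rightarrow> 'n. g \<circ> f)"
    using fun.inj_map[OF bij_is_inj[OF g]] .
  have disj: "G \<inter> (\<lambda>f. g \<circ> f) ` G = {}"
  proof -
    have "g \<circ> f \<notin> G" if "f \<in> G" for f
    proof
      assume "g \<circ> f \<in> G"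
      then have "(g \<circ> f) \<circ> inv' f \<in> G"
        using comp inv that by blast
      moreover have "(g \<circ> f) \<circ> inv' f = g"
        using that sub by (auto simp: fun_eq_iff surj_f_inv_f bij_is_surj)
      ultimately show False using \<open>g \<notin> G\<close> by simp
    qed
    then show ?thesis by blast
  qed
  have out: "g \<circ> g \<notin> (\<lambda>f. g \<circ> f) ` G"
  proof
    assume "g \<circ> g \<in> (\<lambda>f. g \<circ> f) ` G"
    then obtain f where "f \<in> G" "g \<circ> g = g \<circ> f" by blast
    then show False
      using injD[OF inj, of g f] \<open>g \<notin> G\<close> by simp
  qed
  \<comment> \<open>Outside \<open>G\<close> and its coset by \<open>g\<close>, the square is one bijection too many.\<close>
  have "card (insert (g \<circ> g) (G \<union> (\<lambda>f. g \<circ> f) ` G)) = Suc (2 * card G)"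
    using gg out disj card_image[OF inj_on_subset[OF inj subset_UNIV], of G]
    by (simp add: card_Un_disjoint)
  moreover have "insert (g \<circ> g) (G \<union> (\<lambda>f. g \<circ> f) ` G) \<subseteq> {f. bij f}"
    using g sub by (auto intro: bij_comp)
  then have "card (insert (g \<circ> g) (G \<union> (\<lambda>f. g \<circ> f) ` G)) \<le> fact CARD('n)"
    using card_mono[of "{f :: 'n \<Rightarrow> 'n. bij f}"] by (simp add: card_bijections)
  ultimately show False using large by simp
qed

text \<open>Two transpositions that share an index compose to the identity or to a 3-cycle, which is a
  square; an arbitrary pair is reduced to this case by inserting \<open>exchange j k\<close> twice.\<close>

lemma exchange_pair_in_large_subgroup:
  fixes G :: "('n :: finite \<Rightarrow> 'n) set"
  assumes G: "subgroup G (BijGroup UNIV)" and large: "fact CARD('n) \<le> 2 * card G"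
    and "i \<noteq> j" "k \<noteq> l"
  shows "exchange i j \<circ> exchange k l \<in> G"
proof -
  have sub: "G \<subseteq> {f. bij f}"
    using subgroup.subset[OF G] by (simp add: BijGroup_def Bij_UNIV)
  have comp: "f \<circ> h \<in> G" if "f \<in> G" "h \<in> G" for f h
    using subgroup.m_closed[OF G that] subsetD[OF sub] by (simp add: BijGroup_UNIV_mult that)
  have one: "id \<in> G"
  proof -
    have "\<one>\<^bsub>BijGroup UNIV\<^esub> = (id :: 'n \<Rightarrow> 'n)"
      by (simp add: BijGroup_def fun_eq_iff)
    then show ?thesis
      using subgroup.one_closed[OF G] by simp
  qed
  have adjacent: "exchange p q \<circ> exchange q r \<in> G" if "p \<noteq> q" "q \<noteq> r" for p q r :: 'n
  proof (cases "p = r")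
    case True
    then have "exchange p q \<circ> exchange q r = id"
      by (auto simp: fun_eq_iff Transposition.transpose_def)
    with one show ?thesis by simp
  next
    case False
    \<comment> \<open>A 3-cycle is the square of its inverse.\<close>
    let ?g = "exchange q r \<circ> exchange p q"
    have "?g \<circ> ?g = exchange p q \<circ> exchange q r"
      using that False by (auto simp: fun_eq_iff Transposition.transpose_def)
    moreover have "bij ?g" by (intro bij_comp) auto
    ultimately show ?thesis
      using squares_in_large_subgroup[OF G large] by metis
  qed
  show ?thesis
  proof (cases "j = k")
    case True
    then show ?thesis using adjacent assms by simp
  next
    case False
    have "exchange i j \<circ> exchange k l
        = (exchange i j \<circ> exchange j k) \<circ> (exchange j k \<circ> exchange k l)"
      by (simp add: fun_eq_iff)
    then show ?thesis
      using comp adjacent False assms by metis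
  qed
qed

section \<open>Linear programs with a large symmetry group\<close>

lemma even_invariant_lp_feasible:
  fixes G :: "('n :: finite \<Rightarrow> 'n) set"
  assumes "lp_symmetry_group A b c G" "fact CARD('n) \<le> 2 * card G"
  shows "even_invariant {x. lp_feasible A b x}"
  unfolding even_invariant_def
proof (intro ballI allI impI, unfold mem_Collect_eq)
  fix x :: "real ^ 'n" and i j k l :: 'n
  assume x: "lp_feasible A b x" and "i \<noteq> j" "k \<noteq> l"
  let ?p = "exchange k l \<circ> exchange i j"
  let ?y = "\<chi> h. x $ exchange i j (exchange k l h)"
  have "?p \<in> G"
    using assms exchange_pair_in_large_subgroup[OF _ _ \<open>k \<noteq> l\<close> \<open>i \<noteq> j\<close>]
    unfolding lp_symmetry_group_def by blast
  then have "lp_symmetry A b c ?p"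
    using assms unfolding lp_symmetry_group_def by blast
  moreover have "(\<chi> h. ?y $ ?p h) = x"
    by (simp add: vec_eq_iff)
  ultimately show "lp_feasible A b ?y"
    using x symmetry_feasible by metis
qed

text \<open>The product of two transpositions sharing the index \<open>j\<close> carries \<open>i\<close> to \<open>j\<close>, so \<open>G\<close> is transitive.\<close>

lemma objective_constant:
  fixes G :: "('n :: finite \<Rightarrow> 'n) set" and c :: "real ^ 'n"
  assumes "lp_symmetry_group A b c G" "fact CARD('n) \<le> 2 * card G" "CARD('n) \<ge> 3"
  shows "c $ i = c $ j"
proof (cases "i = j")
  case False
  have "card {i, j} < CARD('n)"
    using assms(3) False by simp
  then obtain k where k: "k \<notin> {i, j}"
    by (metis UNIV_eq_I less_irrefl)
  let ?p = "exchange i j \<circ> exchange j k"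
  have "?p \<in> G"
    using assms exchange_pair_in_large_subgroup[OF _ _ False, of G j k] k
    unfolding lp_symmetry_group_def by blast
  then have "lp_symmetry A b c ?p"
    using assms unfolding lp_symmetry_group_def by blast
  moreover have "?p i = j"
    using k False by (auto simp: Transposition.transpose_def)
  ultimately show ?thesis
    using symmetry_objective by metis
qed simp

section \<open>Searching the layers\<close>

text \<open>The search is correct if the list never improves the objective and each layer containing a
  feasible integer point is represented by a layer of the list that is at least as good and all of
  whose neighbors are feasible. The first success is then optimal, because an integer point with a
  larger objective value would have produced a success earlier in the list.\<close>

lemma layer_search_correctI:
  fixes c :: "real ^ 'n"
  assumes sorted: "sorted_wrt (\<lambda>k k'. \<gamma> * of_int k \<ge> \<gamma> * of_int k') ks"
    and c: "c = (\<chi> i. \<gamma>)"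
    and cover: "\<And>y k. ip_feasible A b y \<Longrightarrow> y \<in> c_layer k \<Longrightarrow>
      \<exists>k'\<in>set ks. \<gamma> * of_int k \<le> \<gamma> * of_int k' \<and> (\<forall>N. is_neighbor k' N \<longrightarrow> ip_feasible A b N)"
  shows "layer_search_correct A b c ks"
  unfolding layer_search_correct_def
proof (intro allI impI)
  fix N :: "int \<Rightarrow> real ^ 'n"
  assume N: "\<forall>k\<in>set ks. is_neighbor k (N k)"
  have obj: "c \<bullet> y = \<gamma> * of_int k" if "y \<in> c_layer k" for y k
    using that by (simp add: c inner_vec_def c_layer_def flip: sum_distrib_left)
  have layer: "\<exists>k. y \<in> c_layer k" if "ip_feasible A b y" for y
    using that integer_pointE int_vec_in_layer_iff unfolding ip_feasible_def by metis
  show "case List.find (ip_feasible A b) (map N ks) of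
           Some x \<Rightarrow> ip_solution A b c x | None \<Rightarrow> ip_infeasible A b"
  proof (cases "List.find (ip_feasible A b) (map N ks)")
    case None
    then have "\<forall>k\<in>set ks. \<not> ip_feasible A b (N k)"
      by (auto simp: find_None_iff)
    then have "ip_infeasible A b"
      using cover layer N unfolding ip_infeasible_def by metis
    with None show ?thesis by simp
  next
    case (Some x)
    then obtain i where i: "i < length ks" "ip_feasible A b x" "x = N (ks ! i)"
      and first: "\<forall>j<i. \<not> ip_feasible A b (N (ks ! j))"
      by (auto simp: find_Some_iff)
    have "c \<bullet> y \<le> c \<bullet> x" if y: "ip_feasible A b y" for y
    proof -
      obtain k where k: "y \<in> c_layer k" using layer[OF y] ..
      obtain j where j: "j < length ks" "\<gamma> * of_int k \<le> \<gamma> * of_int (ks ! j)"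
        "ip_feasible A b (N (ks ! j))"
        using cover[OF y k] N by (metis in_set_conv_nth)
      then have "i \<le> j"
        using first by (meson not_le)
      then have "\<gamma> * of_int (ks ! j) \<le> \<gamma> * of_int (ks ! i)"
        using sorted_wrt_nth_less[OF sorted, of i j] j(1) by (cases "i = j") auto
      moreover have "x \<in> c_layer (ks ! i)"
        using N i by (auto simp: is_neighbor_def is_arg_min_def)
      ultimately show ?thesis
        using j(2) obj k by simp
    qed
    then have "ip_solution A b c x"
      using i(2) by (auto simp: ip_solution_def is_arg_max_def not_less)
    with Some show ?thesis by simp
  qed
qed

lemma convex_diagonal_between:
  fixes S :: "(real ^ 'n) set" and t u v :: real
  assumes "convex S" "(\<chi> i. u) \<in> S" "(\<chi> i. v) \<in> S" "u \<le> t" "t \<le> v"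
  shows "(\<chi> i. t) \<in> S"
proof -
  have "t \<in> closed_segment u v"
    using assms(4,5) by (auto simp: closed_segment_eq_real_ivl)
  then obtain r where r: "0 \<le> r" "r \<le> 1" "t = (1 - r) * u + r * v"
    by (auto simp: in_segment)
  then have "(\<chi> i. t) = (1 - r) *\<^sub>R (\<chi> i. u) + r *\<^sub>R (\<chi> i. v)"
    by (simp add: vec_eq_iff)
  also have "\<dots> \<in> S"
    using convexD[OF assms(1-3), of "1 - r" r] r(1,2) by simp
  finally show ?thesis .
qed

lemma length_layers:
  assumes "n > 0"
  shows "length (layers_down n a) \<le> n" "length (layers_up n a) \<le> n"
proof -
  have "real n * a < real n * (of_int \<lfloor>a\<rfloor> + 1)"
    using assms by (intro mult_strict_left_mono) auto
  then have "\<lfloor>real n * a\<rfloor> < int n * (\<lfloor>a\<rfloor> + 1)"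
    by (simp add: floor_less_iff)
  then show "length (layers_down n a) \<le> n"
    by (simp add: layers_down_def algebra_simps)
  have "real n * (of_int \<lceil>a\<rceil> - 1) < real n * a"
    using assms by (intro mult_strict_left_mono) linarith+
  then have "int n * (\<lceil>a\<rceil> - 1) < \<lceil>real n * a\<rceil>"
    by (simp add: less_ceiling_iff)
  then show "length (layers_up n a) \<le> n"
    by (simp add: layers_up_def algebra_simps)
qed

theorem corollary21:
  fixes A :: "real ^ 'n ^ 'm" and b :: "real ^ 'm" and c :: "real ^ 'n"
    and G :: "('n \<Rightarrow> 'n) set" and a :: real
  assumes "CARD('n) \<ge> 5"
    and "c \<noteq> 0"
    and "lp_symmetry_group A b c G"
    and "(BijGroup UNIV)\<lparr>carrier := G\<rparr> \<cong> alt_group CARD('n) \<or>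
         (BijGroup UNIV)\<lparr>carrier := G\<rparr> \<cong> sym_group CARD('n)"
    and "lp_solution A b c (\<chi> i. a)"
  shows "\<exists>\<gamma>. \<gamma> \<noteq> 0 \<and> c = (\<chi> i. \<gamma>) \<and>
           (\<gamma> > 0 \<longrightarrow> layer_search_correct A b c (layers_down CARD('n) a)) \<and>
           (\<gamma> < 0 \<longrightarrow> layer_search_correct A b c (layers_up CARD('n) a)) \<and>
           length (layers_down CARD('n) a) \<le> CARD('n) \<and>
           length (layers_up CARD('n) a) \<le> CARD('n)"
proof -
  let ?n = "CARD('n)"
  let ?S = "{x. lp_feasible A b x}"
  have "card G = fact ?n \<or> 2 * card G = fact ?n"
    using assms(4)
  proof
    assume "(BijGroup UNIV)\<lparr>carrier := G\<rparr> \<cong> alt_group ?n"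
    from iso_same_card[OF this] have "2 * card G = fact ?n"
      using alt_group_card_carrier[of ?n] assms(1) by simp
    then show ?thesis ..
  next
    assume "(BijGroup UNIV)\<lparr>carrier := G\<rparr> \<cong> sym_group ?n"
    from iso_same_card[OF this] have "card G = fact ?n"
      by (simp add: sym_group_card_carrier)
    then show ?thesis ..
  qed
  then have large: "fact ?n \<le> 2 * card G" by auto
  have conv: "convex ?S" by (rule convex_lp_feasible)
  have inv: "even_invariant ?S"
    using even_invariant_lp_feasible[OF assms(3) large] .
  \<comment> \<open>Any entry of \<open>c\<close> will do, since all of them agree.\<close>
  define \<gamma> where "\<gamma> = c $ undefined"
  have c: "c = (\<chi> i. \<gamma>)"
    using objective_constant[OF assms(3) large] assms(1) by (simp add: vec_eq_iff \<gamma>_def)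
  have "\<gamma> \<noteq> 0"
    using assms(2) by (auto simp: c vec_eq_iff)
  have a: "(\<chi> i. a) \<in> ?S"
    using assms(5) by (simp add: lp_solution_def is_arg_max_def)
  have bound: "\<gamma> * of_int k \<le> \<gamma> * (real ?n * a)" if "ip_feasible A b y" "y \<in> c_layer k" for y k
  proof -
    have "c \<bullet> y \<le> c \<bullet> (\<chi> i. a)"
      using assms(5) that(1) by (auto simp: lp_solution_def is_arg_max_def ip_feasible_def not_less)
    moreover have "c \<bullet> y = \<gamma> * of_int k"
      using that(2) by (simp add: c inner_vec_def c_layer_def flip: sum_distrib_left)
    moreover have "c \<bullet> (\<chi> i. a) = \<gamma> * (real ?n * a)"
      by (simp add: c inner_vec_def)
    ultimately show ?thesis by simp
  qed
  have neighbors: "ip_feasible A b N"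
    if "ip_feasible A b y" "y \<in> c_layer k" "is_neighbor k N" for y N k
    using neighbor_mem[OF assms(1) conv inv, of y k N] that
    by (auto simp: ip_feasible_def is_neighbor_def is_arg_min_def)
  have center: "(\<chi> i. of_int k / real ?n) \<in> ?S" if "ip_feasible A b y" "y \<in> c_layer k" for y k
    using that center_mem[OF assms(1) conv inv] unfolding ip_feasible_def layer_center_def
    by (metis int_vec_in_layer_iff integer_pointE mem_Collect_eq)
  have diagonal: "ip_feasible A b (\<chi> i. of_int q)"
      "(\<chi> i. of_int q) \<in> (c_layer (int ?n * q) :: (real ^ 'n) set)"
    if "(\<chi> i. of_int q) \<in> ?S" for q
    using that by (auto simp: ip_feasible_def integer_point_def c_layer_def)
  have down: "layer_search_correct A b c (layers_down ?n a)" if "\<gamma> > 0"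
  proof (rule layer_search_correctI[OF _ c])
    show "sorted_wrt (\<lambda>k k'. \<gamma> * of_int k \<ge> \<gamma> * of_int k') (layers_down ?n a)"
      unfolding layers_down_def sorted_wrt_rev
      using that by (intro sorted_wrt_mono_rel[OF _ sorted_upto]) auto
  next
    fix y k
    assume y: "ip_feasible A b y" "y \<in> c_layer k"
    \<comment> \<open>A layer below the searched range is replaced by the last searched one: \<open>\<lfloor>a\<rfloor>\<close> lies between its
      scaled index \<open>k / n\<close> and \<open>a\<close>, so the integer diagonal point there is feasible.\<close>
    let ?q = "\<lfloor>a\<rfloor>"
    have "of_int k \<le> real ?n * a"
      using bound[OF y] that by simp
    then have le: "k \<le> \<lfloor>real ?n * a\<rfloor>"
      by (simp add: le_floor_iff)
    show "\<exists>k'\<in>set (layers_down ?n a). \<gamma> * of_int k \<le> \<gamma> * of_int k' \<and>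
        (\<forall>N. is_neighbor k' N \<longrightarrow> ip_feasible A b N)"
    proof (cases "int ?n * ?q \<le> k")
      case True
      then show ?thesis
        using le neighbors[OF y] by (intro bexI[of _ k]) (auto simp: layers_down_def)
    next
      case False
      then have k: "of_int k \<le> (of_int (int ?n * ?q) :: real)"
        by (simp only: of_int_le_iff)
      then have "of_int k / real ?n \<le> of_int ?q"
        by (simp add: field_simps)
      then have "(\<chi> i. of_int ?q) \<in> ?S"
        using convex_diagonal_between[OF conv center[OF y] a] by simp
      note q = neighbors[OF diagonal[OF this]]
      have "int ?n * ?q \<le> \<lfloor>real ?n * a\<rfloor>"
        by (simp add: le_floor_iff mult_left_mono)
      then have "int ?n * ?q \<in> set (layers_down ?n a)"
        by (simp add: layers_down_def)
      moreover have "\<gamma> * of_int k \<le> \<gamma> * of_int (int ?n * ?q)"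
        using k that by (intro mult_left_mono) auto
      ultimately show ?thesis
        using q by blast
    qed
  qed
  have up: "layer_search_correct A b c (layers_up ?n a)" if "\<gamma> < 0"
  proof (rule layer_search_correctI[OF _ c])
    show "sorted_wrt (\<lambda>k k'. \<gamma> * of_int k \<ge> \<gamma> * of_int k') (layers_up ?n a)"
      unfolding layers_up_def
      using that by (intro sorted_wrt_mono_rel[OF _ sorted_upto]) auto
  next
    fix y k
    assume y: "ip_feasible A b y" "y \<in> c_layer k"
    let ?q = "\<lceil>a\<rceil>"
    have "real ?n * a \<le> of_int k"
      using bound[OF y] that by simp
    then have le: "\<lceil>real ?n * a\<rceil> \<le> k"
      by (simp add: ceiling_le_iff)
    show "\<exists>k'\<in>set (layers_up ?n a). \<gamma> * of_int k \<le> \<gamma> * of_int k' \<and>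
        (\<forall>N. is_neighbor k' N \<longrightarrow> ip_feasible A b N)"
    proof (cases "k \<le> int ?n * ?q")
      case True
      then show ?thesis
        using le neighbors[OF y] by (intro bexI[of _ k]) (auto simp: layers_up_def)
    next
      case False
      then have k: "(of_int (int ?n * ?q) :: real) \<le> of_int k"
        by (simp only: of_int_le_iff)
      then have "of_int ?q \<le> of_int k / real ?n"
        by (simp add: field_simps)
      then have "(\<chi> i. of_int ?q) \<in> ?S"
        using convex_diagonal_between[OF conv a center[OF y]] by simp
      note q = neighbors[OF diagonal[OF this]]
      have "\<lceil>real ?n * a\<rceil> \<le> int ?n * ?q"
        by (simp add: ceiling_le_iff mult_left_mono)
      then have "int ?n * ?q \<in> set (layers_up ?n a)"
        by (simp add: layers_up_def)
      moreover have "\<gamma> * of_int k \<le> \<gamma> * of_int (int ?n * ?q)"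
        using k that by (intro mult_left_mono_neg) auto
      ultimately show ?thesis
        using q by blast
    qed
  qed
  show ?thesis
    using \<open>\<gamma> \<noteq> 0\<close> c down up length_layers[of ?n a] by (intro exI[of _ \<gamma>]) simp
qed

end
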